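(* Fix a scenario $\omega$, and let the futures market quantities $q_k^F$ ($k\in I\cup J$) and the futures allowance commitments $\varepsilon_i^F$ ($i\in I$) be given. Assume that $\beta_\omega^S(1+\delta_i)+c_{i\omega}\neq 0$ for every $i\in I$, put $$\tau_{i\omega}=\frac{1}{\beta_{\omega}^S(1+\delta_i)+c_{i\omega}}\quad (i\in I),$$ assume $1+\beta_\omega^S\sum_{i\in I}\tau_{i\omega}\neq 0$, and put $$\varphi_{\omega}=\frac{1}{1+\beta_{\omega}^S\sum_{i\in I}\tau_{i\omega}}.$$ If $\big((q_{i\omega}^S)_{i\in I},P_\omega^S\big)$ is a spot market equilibrium in scenario $\omega$ with conjectural parameters $(\delta_i)_{i\in I}$, then for every $i\in I$ the equilibrium amount of shortage/surplus of emission allowances $\varepsilon_{i\omega}^S$ of generator $i$ in the spot market is $$\begin{aligned}\varepsilon_{i\omega}^S={}&\hat{\eta}_{i\omega}\sum_{l\in I}q_l^F+\hat{\eta}_{i\omega}\sum_{l\in I}\tau_{l\omega}\varphi_{\omega}\left[\hat{\gamma}_{\omega}^{S}+\beta_{\omega}^S\sum_{m\in I}\tau_{m\omega}\left(b_{m\omega}+c_{m\omega}q_{m}^F+\hat{\eta}_{m\omega}P_{\omega}^{S_{CO_2}}\right)\right]-\varepsilon_i^F\\&-\hat{\eta}_{i\omega}\sum_{l\in I}\tau_{l\omega}\varphi_{\omega}\beta_{\omega}^S\sum_{m\in I}q_m^F-\hat{\eta}_{i\omega}\sum_{l\in I}\tau_{l\omega}\left[b_{l\omega}+c_{l\omeg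a}q_{l}^F+\hat{\eta}_{l\omega}P_{\omega}^{S_{CO_2}}\right].\end{aligned}$$
   Context: $I$ is a finite set of conventional generators, $J$ a finite set of renewable generators, and $\omega$ denotes a scenario. In scenario $\omega$ the following real parameters are given: $\gamma_\omega^S>0$ and $\beta_\omega^S>0$ (spot inverse demand intercept and slope); the renewable productions $Q_{j\omega}$ ($j\in J$), which are always fully dispatched; cost coefficients $a_{i\omega},b_{i\omega},c_{i\omega}\ge 0$ ($i\in I$); emission intensity factors $\hat\eta_{i\omega}$ ($i\in I$); and the exogenous spot price of emission allowances $P_\omega^{S_{CO_2}}$. The futures quantities $q_k^F$ ($k\in I\cup J$), the futures price, and the futures allowance commitments $\varepsilon_i^F$ ($i\in I$) are already settled and are treated as fixed real constants in the spot market. Spot quantities $q_{i\omega}^S$ ($i\in I$) are unconstrained real numbers. Production cost of conventional generator $i$: $C_{i\omega}(q_i^F,q_{i\omega}^S)=a_{i\omega}+b_{i\omega}(q_i^F+q_{i\omega}^S)+\tfrac12 c_{i\omega}(q_i^F+q_{i\omega}^S)^2$. Spot profit of conventional generator $i$: $$\Pi_{i\omega}^S=P^S_{\omega}q_{i\omega}^S-C_{i\omega}(q_i^F,q_{i\omega}^S)+P_{\omega}^{S_{CO_2}}\big(\varepsilon_{i}^F-\hat{\eta}_{i\omega}(q_i^F+q_{i\omega}^S)\big).$$ Spot inverse demand: $P_{\omega}^{S}=\hat{\gamma}_{\omega}^{S}-\beta_{\omega}^S\sum_{i\in I}(q_{i\omega}^S+q_i^F)$, where $\hat{\gamma}_{\omega}^{S}=\gamma_{\omega}^{S}-\beta_{\omega}^S\sum_{j\in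 J}Q_{j\omega}$. Spot emission allowances of generator $i$ (definition): $\varepsilon_{i\omega}^S=\hat{\eta}_{i\omega}\sum_{l\in I}(q_{l\omega}^S+q_l^F)-\varepsilon_i^F$; generator $i$ has a shortage if this is positive and a surplus if it is negative. Conjectures: each $i\in I$ has a given real constant $\delta_i=\sum_{k\in I,\,k\neq i}\frac{\partial q_{k\omega}^S}{\partial q_{i\omega}^S}$, the total response of its rivals' spot quantities that it conjectures ($\delta_i=-1$ represents perfect competition, $\delta_i=0$ Cournot competition). Hence generator $i$ perceives $\frac{\partial P_\omega^S}{\partial q_{i\omega}^S}=-\beta_\omega^S(1+\delta_i)$. A spot market equilibrium in scenario $\omega$ is a pair $\big((q_{i\omega}^S)_{i\in I},P_\omega^S\big)$ of real quantities and a real price such that the spot inverse demand relation holds and, simultaneously for every $i\in I$, the first-order condition for maximizing $\Pi_{i\omega}^S$ with respect to $q_{i\omega}^S$ holds, the derivative being computed with generator $i$'s perceived price derivative. That is, at $x=q_{i\omega}^S$ the derivative in $x$ of $$x\mapsto \big(P_\omega^S-\beta_\omega^S(1+\delta_i)(x-q_{i\omega}^S)\big)x-C_{i\omega}(q_i^F,x)+P_{\omega}^{S_{CO_2}}\big(\varepsilon_{i}^F-\hat{\eta}_{i\omega}(q_i^F+x)\big)$$ is zero. *)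

theory Defs
  imports Complex_Main
begin

text \<open>Generators have type \<open>'g\<close>, scenarios type \<open>'w\<close>.\<close>

record ('g, 'w) electricity_market =
  conventional :: "'g set"
  renewable :: "'g set"
  demand_intercept :: "'w \<Rightarrow> real"
  demand_slope :: "'w \<Rightarrow> real"
  renewable_output :: "'g \<Rightarrow> 'w \<Rightarrow> real"
  cost_a :: "'g \<Rightarrow> 'w \<Rightarrow> real"
  cost_b :: "'g \<Rightarrow> 'w \<Rightarrow> real"
  cost_c :: "'g \<Rightarrow> 'w \<Rightarrow> real"
  emission_intensity :: "'g \<Rightarrow> 'w \<Rightarrow> real"
  allowance_price :: "'w \<Rightarrow> real"

definition admissible_market :: "('g, 'w) electricity_market \<Rightarrow> 'w \<Rightarrow> bool" where
  "admissible_market M \<omega> \<longleftrightarrow>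
     finite (conventional M) \<and> finite (renewable M) \<and>
     demand_intercept M \<omega> > 0 \<and> demand_slope M \<omega> > 0 \<and>
     (\<forall>i\<in>conventional M. cost_a M i \<omega> \<ge> 0 \<and> cost_b M i \<omega> \<ge> 0 \<and> cost_c M i \<omega> \<ge> 0)"

text \<open>
  Throughout, \<open>qF\<close> and \<open>epsF\<close> are the settled futures quantities and futures
  allowance commitments, and \<open>q\<close> are the spot quantities in scenario \<open>\<omega>\<close>.
  Renewable production is always fully dispatched, so it is netted off the demand intercept.
\<close>

definition residual_intercept :: "('g, 'w) electricity_market \<Rightarrow> 'w \<Rightarrow> real" where
  "residual_intercept M \<omega> =
     demand_intercept M \<omega> - demand_slope M \<omega> * (\<Sum>j\<in>renewable M. renewable_output M j \<omega>)"

definition inverse_demand ::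
  "('g, 'w) electricity_market \<Rightarrow> 'w \<Rightarrow> ('g \<Rightarrow> real) \<Rightarrow> ('g \<Rightarrow> real) \<Rightarrow> real" where
  "inverse_demand M \<omega> qF q =
     residual_intercept M \<omega> - demand_slope M \<omega> * (\<Sum>i\<in>conventional M. q i + qF i)"

definition production_cost ::
  "('g, 'w) electricity_market \<Rightarrow> 'w \<Rightarrow> 'g \<Rightarrow> real \<Rightarrow> real \<Rightarrow> real" where
  "production_cost M \<omega> i x y =
     cost_a M i \<omega> + cost_b M i \<omega> * (x + y) + 1 / 2 * cost_c M i \<omega> * (x + y)\<^sup>2"

definition spot_profit ::
  "('g, 'w) electricity_market \<Rightarrow> 'w \<Rightarrow> ('g \<Rightarrow> real) \<Rightarrow> ('g \<Rightarrow> real) \<Rightarrow> 'g \<Rightarrow> real \<Rightarrow> real \<Rightarrow> real"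
  where
  "spot_profit M \<omega> qF epsF i P x =
     P * x - production_cost M \<omega> i (qF i) x
     + allowance_price M \<omega> * (epsF i - emission_intensity M i \<omega> * (qF i + x))"

text \<open>
  The conjecture \<open>\<delta> i\<close> is the total response of the rivals' spot quantities to the spot
  quantity of \<open>i\<close>, so \<open>i\<close> perceives the price derivative
  \<open>- demand_slope M \<omega> * (1 + \<delta> i)\<close>; this is the price that \<open>i\<close> perceives
  when it deviates from \<open>q i\<close> to \<open>x\<close>.
\<close>

definition perceived_price ::
  "('g, 'w) electricity_market \<Rightarrow> 'w \<Rightarrow> ('g \<Rightarrow> real) \<Rightarrow> ('g \<Rightarrow> real) \<Rightarrow> real \<Rightarrow> 'g \<Rightarrow> real \<Rightarrow> real"
  where
  "perceived_price M \<omega> \<delta> q P i x = P - demand_slope M \<omega> * (1 + \<delta> i) * (x - q i)"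

definition spot_equilibrium ::
  "('g, 'w) electricity_market \<Rightarrow> 'w \<Rightarrow> ('g \<Rightarrow> real) \<Rightarrow> ('g \<Rightarrow> real) \<Rightarrow> ('g \<Rightarrow> real) \<Rightarrow>
   ('g \<Rightarrow> real) \<Rightarrow> real \<Rightarrow> bool" where
  "spot_equilibrium M \<omega> qF epsF \<delta> q P \<longleftrightarrow>
     P = inverse_demand M \<omega> qF q \<and>
     (\<forall>i\<in>conventional M.
        ((\<lambda>x. spot_profit M \<omega> qF epsF i (perceived_price M \<omega> \<delta> q P i x) x)
           has_real_derivative 0) (at (q i)))"

text \<open>Positive values are a shortage of allowances, negative values a surplus.\<close>

definition spot_allowances ::
  "('g, 'w) electricity_market \<Rightarrow> 'w \<Rightarrow> ('g \<Rightarrow> real) \<Rightarrow> ('g \<Rightarrow> real) \<Rightarrow> ('g \<Rightarrow> real) \<Rightarrow> 'g \<Rightarrow> real"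
  where
  "spot_allowances M \<omega> qF epsF q i =
     emission_intensity M i \<omega> * (\<Sum>l\<in>conventional M. q l + qF l) - epsF i"

definition tau :: "('g, 'w) electricity_market \<Rightarrow> 'w \<Rightarrow> ('g \<Rightarrow> real) \<Rightarrow> 'g \<Rightarrow> real" where
  "tau M \<omega> \<delta> i = 1 / (demand_slope M \<omega> * (1 + \<delta> i) + cost_c M i \<omega>)"

definition phi :: "('g, 'w) electricity_market \<Rightarrow> 'w \<Rightarrow> ('g \<Rightarrow> real) \<Rightarrow> real" where
  "phi M \<omega> \<delta> = 1 / (1 + demand_slope M \<omega> * (\<Sum>i\<in>conventional M. tau M \<omega> \<delta> i))"

end

theory Submission
  imports Defs
begin

text \<open>
  Each first-order condition is affine and gives the supply function \<open>q i = tau i * (P - k i)\<close>,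
  where \<open>k i\<close> is the marginal cost, emission cost included, at zero spot quantity.
  Summing over \<open>i\<close> and substituting the inverse demand leaves a single linear equation for the
  total spot quantity, with leading coefficient \<open>1 + demand_slope * (\<Sum>i. tau i) = 1 / phi\<close>.
\<close>

text \<open>The perceived price equals \<open>P\<close> at \<open>x = q i\<close>, so the product
  rule yields \<open>P\<close> plus the markup term
  \<open>- demand_slope M \<omega> * (1 + \<delta> i) * q i\<close>; marginal cost is split into its
  part linear in \<open>q i\<close> and the rest.\<close>

lemma perceived_spot_profit_has_derivative:
  "((\<lambda>x. spot_profit M \<omega> qF epsF i (perceived_price M \<omega> \<delta> q P i x) x) has_real_derivative
     P - (demand_slope M \<omega> * (1 + \<delta> i) + cost_c M i \<omega>) * q i
       - (cost_b M i \<omega> + cost_c M i \<omega> * qF i + emission_intensity M i \<omega> * allowance_price M \<omega>))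
     (at (q i))"
  unfolding spot_profit_def perceived_price_def production_cost_def
  by (auto intro!: derivative_eq_intros simp: algebra_simps)

lemma spot_equilibrium_quantity:
  assumes "spot_equilibrium M \<omega> qF epsF \<delta> q P" and "i \<in> conventional M"
    and "demand_slope M \<omega> * (1 + \<delta> i) + cost_c M i \<omega> \<noteq> 0"
  shows "q i = tau M \<omega> \<delta> i * (P -
    (cost_b M i \<omega> + cost_c M i \<omega> * qF i + emission_intensity M i \<omega> * allowance_price M \<omega>))"
proof -
  have "((\<lambda>x. spot_profit M \<omega> qF epsF i (perceived_price M \<omega> \<delta> q P i x) x)
      has_real_derivative 0) (at (q i))"
    using assms unfolding spot_equilibrium_def by blast
  from DERIV_unique[OF perceived_spot_profit_has_derivative this] assms(3)
  show ?thesis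
    by (simp add: tau_def field_simps)
qed

text \<open>Market clearing freed of sums: \<open>S\<close> and \<open>F\<close> stand for the total
  spot and futures quantities, \<open>T\<close> for the sum of the \<open>tau i\<close>,
  \<open>K\<close> for that of the \<open>tau i * k i\<close>, \<open>g\<close> for the residual
  intercept.\<close>

lemma market_clearing_solution:
  fixes S T K F g \<beta> P :: real
  assumes "1 + \<beta> * T \<noteq> 0" and "S = T * P - K" and "P = g - \<beta> * (S + F)"
  shows "S = T * (1 / (1 + \<beta> * T)) * (g + \<beta> * K) - T * (1 / (1 + \<beta> * T)) * \<beta> * F - K"
proof -
  \<comment> \<open>With the reciprocal as an atom subject to this relation, the goal is a
    polynomial consequence of the assumptions, as \<open>algebra\<close> requires.\<close>
  have "1 / (1 + \<beta> * T) * (1 + \<beta> * T) = 1"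
    using assms(1) by simp
  with assms(2,3) show ?thesis
    by algebra
qed

theorem proposition3:
  fixes M :: "('g, 'w) electricity_market"
    and \<omega> :: 'w
    and qF epsF \<delta> q :: "'g \<Rightarrow> real"
    and P :: real
  assumes "admissible_market M \<omega>"
    and "\<forall>i\<in>conventional M. demand_slope M \<omega> * (1 + \<delta> i) + cost_c M i \<omega> \<noteq> 0"
    and "1 + demand_slope M \<omega> * (\<Sum>i\<in>conventional M. tau M \<omega> \<delta> i) \<noteq> 0"
    and "spot_equilibrium M \<omega> qF epsF \<delta> q P"
  shows "\<forall>i\<in>conventional M.
    spot_allowances M \<omega> qF epsF q i =
      emission_intensity M i \<omega> * (\<Sum>l\<in>conventional M. qF l)
      + emission_intensity M i \<omega> *
          (\<Sum>l\<in>conventional M. tau M \<omega> \<delta> l * phi M \<omega> \<delta> *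
            (residual_intercept M \<omega> + demand_slope M \<omega> *
              (\<Sum>m\<in>conventional M. tau M \<omega> \<delta> m *
                (cost_b M m \<omega> + cost_c M m \<omega> * qF m
                 + emission_intensity M m \<omega> * allowance_price M \<omega>))))
      - epsF i
      - emission_intensity M i \<omega> *
          (\<Sum>l\<in>conventional M. tau M \<omega> \<delta> l * phi M \<omega> \<delta> * demand_slope M \<omega> *
            (\<Sum>m\<in>conventional M. qF m))
      - emission_intensity M i \<omega> *
          (\<Sum>l\<in>conventional M. tau M \<omega> \<delta> l *
            (cost_b M l \<omega> + cost_c M l \<omega> * qF l
             + emission_intensity M l \<omega> * allowance_price M \<omega>))"
proof -
  let ?I = "conventional M"
  let ?\<beta> = "demand_slope M \<omega>"
  let ?k = "\<lambda>m. cost_b M m \<omega> + cost_c M m \<omega> * qF m + emission_intensity M m \<omega> * allowance_price M \<omega>"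
  let ?T = "\<Sum>l\<in>?I. tau M \<omega> \<delta> l"
  let ?K = "\<Sum>l\<in>?I. tau M \<omega> \<delta> l * ?k l"
  let ?F = "\<Sum>l\<in>?I. qF l"
  have "(\<Sum>l\<in>?I. q l) = (\<Sum>l\<in>?I. tau M \<omega> \<delta> l * (P - ?k l))"
    using assms(2) by (intro sum.cong refl spot_equilibrium_quantity[OF assms(4)]) auto
  also have "\<dots> = ?T * P - ?K"
    by (simp only: right_diff_distrib sum_subtractf sum_distrib_right)
  finally have total: "(\<Sum>l\<in>?I. q l) = ?T * P - ?K" .
  have "P = residual_intercept M \<omega> - ?\<beta> * ((\<Sum>l\<in>?I. q l) + ?F)"
    using assms(4) by (simp add: spot_equilibrium_def inverse_demand_def sum.distrib)
  from market_clearing_solution[OF assms(3) total this]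
  have solution: "(\<Sum>l\<in>?I. q l) = ?T * phi M \<omega> \<delta> * (residual_intercept M \<omega> + ?\<beta> * ?K)
      - ?T * phi M \<omega> \<delta> * ?\<beta> * ?F - ?K"
    by (simp only: phi_def)
  show ?thesis
    \<comment> \<open>Factors independent of the summation index are pulled out, so that the only
      sums left are \<open>?T\<close>, \<open>?K\<close> and \<open>?F\<close>.\<close>
    unfolding spot_allowances_def sum.distrib[of q qF] sum_distrib_right[symmetric] solution
    by (simp add: algebra_simps)
qed

end
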